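(* There is no $o\!\left(\frac{n}{\sum_{i=1}^n a_i}\right)$ time randomized approximation scheme algorithm for the sum problem.
   Context: The sum problem: given a list of nonnegative real numbers $a_1,\ldots,a_n$, approximate the sum $\sum_{i=1}^n a_i$. For a real number $\epsilon\ge 0$, a real number $s$ is a $(1+\epsilon)$-approximation for the sum problem $a_1,\ldots,a_n$ if $\frac{1}{1+\epsilon}\sum_{i=1}^n a_i\le s\le (1+\epsilon)\sum_{i=1}^n a_i$. An approximation scheme is understood in the usual sense: it provides a $(1+\epsilon)$-approximation for every constant $\epsilon>0$. In the randomized model considered, the input list is accessed by uniform random sampling, which selects one element of the list with equal probability each time. *)

theory Defs
  imports "HOL-Probability.Probability" "HOL-Library.Landau_Symbols"
begin

definition sum_inputs :: "real list set" where
  "sum_inputs = {a. a \<noteq> [] \<and> (\<forall>x\<in>set a. 0 \<le> x)}"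

definition is_approximation :: "real \<Rightarrow> real list \<Rightarrow> real \<Rightarrow> bool" where
  "is_approximation \<epsilon> a s \<longleftrightarrow>
     1 / (1 + \<epsilon>) * sum_list a \<le> s \<and> s \<le> (1 + \<epsilon>) * sum_list a"

text \<open>
  Randomized programs whose only access to the input list is uniform random sampling.
  A \<open>Sample\<close> node receives the selected position together with the element stored there.
  An \<open>Internal\<close> node is one step of computation independent of the input; a point mass
  gives a deterministic step, a two-point distribution a coin toss. The type is
  coinductive, so a program may fail to halt.

  Every \<open>Sample\<close> and every \<open>Internal\<close> node costs one unit of time. How much
  deterministic work one step performs is not limited, so time in any machine model that
  charges at least one unit per sampled element is bounded below by time here.
\<close>

codatatype program =
    Halt real
  | Internal "program pmf"
  | Sample "nat \<Rightarrow> real \<Rightarrow> program"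

text \<open>
  Outcome of running a program on \<open>a\<close> for at most \<open>t\<close> time units;
  \<open>None\<close> means that it has not halted by then. Meaningful for nonempty \<open>a\<close> only.
\<close>

primrec run :: "real list \<Rightarrow> nat \<Rightarrow> program \<Rightarrow> real option pmf" where
  "run a 0 P = (case P of Halt s \<Rightarrow> return_pmf (Some s) | _ \<Rightarrow> return_pmf None)"
| "run a (Suc t) P = (case P of
       Halt s \<Rightarrow> return_pmf (Some s)
     | Internal q \<Rightarrow> bind_pmf q (run a t)
     | Sample f \<Rightarrow> bind_pmf (pmf_of_set {..<length a}) (\<lambda>i. run a t (f i (a ! i))))"

text \<open>
  With probability at least \<open>p\<close>, the program halts within \<open>t\<close> time units and
  outputs a \<open>(1 + \<epsilon>)\<close>-approximation.
\<close>

definition approximates_in_time ::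
  "real \<Rightarrow> real \<Rightarrow> real list \<Rightarrow> nat \<Rightarrow> program \<Rightarrow> bool" where
  "approximates_in_time p \<epsilon> a t P \<longleftrightarrow>
     p \<le> measure_pmf.prob (run a t P) {Some s |s. is_approximation \<epsilon> a s}"

text \<open>
  \<open>A \<epsilon> n\<close> is the program used for accuracy \<open>\<epsilon>\<close> on lists of length \<open>n\<close>, so the
  length is known to the algorithm. \<open>T \<epsilon> a\<close> bounds its time on \<open>a\<close>.
\<close>

definition randomized_approximation_scheme ::
  "real \<Rightarrow> (real \<Rightarrow> nat \<Rightarrow> program) \<Rightarrow> (real \<Rightarrow> real list \<Rightarrow> nat) \<Rightarrow> bool" where
  "randomized_approximation_scheme p A T \<longleftrightarrow>
     (\<forall>\<epsilon>>0. \<forall>a\<in>sum_inputs. approximates_in_time p \<epsilon> a (T \<epsilon> a) (A \<epsilon> (length a)))"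

text \<open>
  The regime in which both \<open>n\<close> and \<open>n / (\<Sum>i. a\<^sub>i)\<close> tend to infinity. Letting only \<open>n\<close>
  grow would make an \<open>o(n / (\<Sum>i. a\<^sub>i))\<close> bound force time \<open>0\<close> on lists whose sum is at
  least \<open>n\<close>. Since \<open>x / 0 = 0\<close>, lists with sum \<open>0\<close> are excluded, i.e. the time on them
  is not restricted.
\<close>

definition large_ratio :: "real list filter" where
  "large_ratio =
     inf (inf (filtercomap length at_top)
              (filtercomap (\<lambda>a. real (length a) / sum_list a) at_top))
         (principal sum_inputs)"

end

theory Submission
  imports Defs "HOL-Real_Asymp.Real_Asymp"
begin

text \<open>
  Two lists of length \<open>n\<close> that differ in a single position are told apart by a program only when
  it samples that position, which within \<open>t\<close> steps happens with probability at most \<open>t / n\<close>.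
  The lists \<open>1, 0, \<dots>, 0\<close> and \<open>4, 0, \<dots>, 0\<close> have disjoint sets of \<open>3/2\<close>-approximations. Running
  the program for \<open>o(n)\<close> steps would hit each of the two sets with probability about \<open>p > 1/2\<close> on
  one and the same list.
\<close>

lemma prob_bind_pmf:
  "measure_pmf.prob (bind_pmf q f) S = (\<integral>x. measure_pmf.prob (f x) S \<partial>measure_pmf q)"
  by (simp add: measure_pmf_bind
      measure_pmf.measure_bind[where N = "count_space UNIV"] measurable_def
      space_subprob_algebra subprob_space_measure_pmf)

lemma integrable_prob_pmf [simp]:
  "integrable (measure_pmf q) (\<lambda>x. measure_pmf.prob (f x) S)"
  by (rule measure_pmf.integrable_const_bound[where B = 1]) auto

text \<open>A halted run keeps its output when more time is allowed, so extra time only moves mass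
  away from \<open>None\<close>. This lets runs with different time bounds be compared at a common
  one.\<close>

lemma prob_run_mono:
  assumes "None \<notin> S" "t \<le> t'"
  shows "measure_pmf.prob (run a t P) S \<le> measure_pmf.prob (run a t' P) S"
proof -
  have step: "measure_pmf.prob (run a t P) S \<le> measure_pmf.prob (run a (Suc t) P) S" for t
  proof (induction t arbitrary: P)
    case 0
    show ?case
      using assms(1) by (cases P) auto
  next
    case (Suc t)
    show ?case
    proof (cases P)
      case (Internal q)
      then show ?thesis
        using Suc.IH by (simp only: run.simps program.case prob_bind_pmf) (intro integral_mono; simp)
    next
      case (Sample f)
      then show ?thesis
        using Suc.IH by (simp only: run.simps program.case prob_bind_pmf) (intro integral_mono; simp)
    qed simp
  qed
  show ?thesis
    using assms(2) by (rule lift_Suc_mono_le[where f = "\<lambda>t. measure_pmf.prob (run a t P) S", OF step])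
qed

text \<open>Coupling argument: let both runs make the same internal choices and sample the same
  positions. They can diverge only after sampling a position in \<open>D\<close>, and a union bound
  over at most \<open>t\<close> samples gives the error term.\<close>

lemma prob_run_diff:
  assumes "length a = length b" "a \<noteq> []"
  defines "D \<equiv> {i. i < length a \<and> a ! i \<noteq> b ! i}"
  shows "measure_pmf.prob (run a t P) S
    \<le> measure_pmf.prob (run b t P) S + real t * (card D / length a)"
proof (induction t arbitrary: P)
  case 0
  show ?case
    by (cases P) auto
next
  case (Suc t)
  let ?c = "real t * (card D / length a)"
  have c_le: "?c \<le> real (Suc t) * (card D / length a)"
    by (intro mult_right_mono) auto
  show ?case
  proof (cases P)
    case (Halt s)
    then show ?thesis
      by simp
  next
    case (Internal q)
    have "(\<integral>x. measure_pmf.prob (run a t x) S \<partial>measure_pmf q)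
        \<le> (\<integral>x. measure_pmf.prob (run b t x) S + ?c \<partial>measure_pmf q)"
      using Suc.IH by (intro integral_mono) auto
    also have "\<dots> = (\<integral>x. measure_pmf.prob (run b t x) S \<partial>measure_pmf q) + ?c"
      by simp
    finally show ?thesis
      using Internal c_le by (simp add: prob_bind_pmf)
  next
    case (Sample f)
    let ?u = "pmf_of_set {..<length a}"
    have ne: "{..<length a} \<noteq> {}"
      using assms(2) by (simp add: lessThan_empty_iff)
    have set_u: "set_pmf ?u = {..<length a}"
      using ne by simp
    have D: "{..<length a} \<inter> D = D"
      by (auto simp: D_def)
    \<comment> \<open>Outside \<open>D\<close> both runs continue with the same subprogram, so the
      induction hypothesis applies. On \<open>D\<close> the trivial bound 1 is paid for by the
      indicator, whose mean is the cost of one more sample.\<close>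
    have pointwise: "measure_pmf.prob (run a t (f i (a ! i))) S
        \<le> measure_pmf.prob (run b t (f i (b ! i))) S + (?c + indicator D i)"
      if "i < length a" for i
    proof (cases "a ! i = b ! i")
      case True
      then show ?thesis
        using Suc.IH[of "f i (a ! i)"] by (simp add: D_def)
    next
      case False
      have "measure_pmf.prob (run a t (f i (a ! i))) S \<le> 1"
        by simp
      also have "\<dots> \<le> measure_pmf.prob (run b t (f i (b ! i))) S + (?c + 1)"
        by simp
      finally show ?thesis
        using False that by (simp add: D_def)
    qed
    have int_D: "integrable ?u (indicator D :: nat \<Rightarrow> real)"
      by (rule measure_pmf.integrable_const_bound[where B = 1]) (auto simp: indicator_def)
    have "(\<integral>i. measure_pmf.prob (run a t (f i (a ! i))) S \<partial>?u)
        \<le> (\<integral>i. measure_pmf.prob (run b t (f i (b ! i))) S + (?c + indicator D i) \<partial>?u)"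
      using pointwise set_u int_D
      by (intro integral_mono_AE) (auto simp: AE_measure_pmf_iff)
    also have "\<dots> = (\<integral>i. measure_pmf.prob (run b t (f i (b ! i))) S \<partial>?u)
        + (?c + measure_pmf.prob ?u D)"
      using int_D by simp
    also have "measure_pmf.prob ?u D = card D / length a"
      using ne by (simp add: measure_pmf_of_set D)
    finally show ?thesis
      using Sample assms(1) by (simp add: prob_bind_pmf algebra_simps add_divide_distrib)
  qed
qed

text \<open>The sum stays \<open>x\<close> while the length grows, so these lists lie in the regime
  of the little-o bound and turn it into a bound of order o(n) along a sequence.\<close>

lemma filterlim_large_ratio:
  fixes x :: real
  assumes "0 < x"
  shows "filterlim (\<lambda>n. x # replicate n 0) large_ratio sequentially"
proof -
  have "filterlim (\<lambda>n. Suc n) at_top sequentially"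
    by (rule filterlim_Suc)
  moreover have "filterlim (\<lambda>n. real (Suc n) / x) at_top sequentially"
    using assms by real_asymp
  ultimately show ?thesis
    using assms unfolding large_ratio_def
    by (auto simp: filterlim_inf filterlim_filtercomap_iff filterlim_principal sum_inputs_def o_def
        sum_list_replicate)
qed

theorem corollary2:
  fixes p :: real
  assumes "1 / 2 < p"
  shows "\<not> (\<exists>A T. randomized_approximation_scheme p A T \<and>
           (\<forall>\<epsilon>>0. (\<lambda>a. real (T \<epsilon> a)) \<in> o[large_ratio](\<lambda>a. real (length a) / sum_list a)))"
proof
  assume "\<exists>A T. randomized_approximation_scheme p A T \<and>
           (\<forall>\<epsilon>>0. (\<lambda>a. real (T \<epsilon> a)) \<in> o[large_ratio](\<lambda>a. real (length a) / sum_list a))"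
  then obtain A T where scheme: "randomized_approximation_scheme p A T"
    and small: "\<And>\<epsilon>. 0 < \<epsilon> \<Longrightarrow>
      (\<lambda>a. real (T \<epsilon> a)) \<in> o[large_ratio](\<lambda>a. real (length a) / sum_list a)"
    by blast
  define \<epsilon> :: real where "\<epsilon> = 1 / 2"
  \<comment> \<open>The slack in the final count: the two success probabilities will give 2p \<le> 1
    + c = p + 1/2, contradicting p > 1/2.\<close>
  define c where "c = p - 1 / 2"
  have c: "0 < c"
    using assms by (simp add: c_def)
  have "\<forall>\<^sub>F a in large_ratio. norm (real (T \<epsilon> a)) \<le> c * norm (real (length a) / sum_list a)"
    using landau_o.smallD[OF small c] by (simp add: \<epsilon>_def)
  then have time: "\<forall>\<^sub>F n in sequentially. norm (real (T \<epsilon> (x # replicate n 0)))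
      \<le> c * norm (real (length (x # replicate n 0)) / sum_list (x # replicate n 0))"
    if "0 < x" for x
    using filterlim_large_ratio[OF that] unfolding filterlim_iff by blast
  have "\<forall>\<^sub>F n in sequentially. real (T \<epsilon> (1 # replicate n 0)) \<le> c * Suc n \<and>
      real (T \<epsilon> (4 # replicate n 0)) \<le> c * (Suc n / 4)"
    using eventually_conj[OF time[of 1] time[of 4]] by (simp add: sum_list_replicate)
  then obtain n where Ta: "real (T \<epsilon> (1 # replicate n 0)) \<le> c * Suc n"
    and Tb: "real (T \<epsilon> (4 # replicate n 0)) \<le> c * (Suc n / 4)"
    by (auto simp: eventually_sequentially)
  define a b where "a = 1 # replicate n (0::real)" and "b = 4 # replicate n (0::real)"
  \<comment> \<open>The time bound may differ on the two lists, whereas the coupling needs one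
    common time.\<close>
  define t where "t = max (T \<epsilon> a) (T \<epsilon> b)"
  \<comment> \<open>Both lists have length \<open>Suc n\<close>, so the scheme runs the same program
    on them.\<close>
  define P where "P = A \<epsilon> (Suc n)"
  define Sa Sb where "Sa = {Some s |s. is_approximation \<epsilon> a s}"
    and "Sb = {Some s |s. is_approximation \<epsilon> b s}"
  have in_inputs: "a \<in> sum_inputs" "b \<in> sum_inputs"
    by (auto simp: a_def b_def sum_inputs_def)
  have correct: "p \<le> measure_pmf.prob (run x (T \<epsilon> x) (A \<epsilon> (length x)))
      {Some s |s. is_approximation \<epsilon> x s}" if "x \<in> sum_inputs" for x
    using scheme that
    unfolding randomized_approximation_scheme_def approximates_in_time_def \<epsilon>_def by simp
  have "p \<le> measure_pmf.prob (run a (T \<epsilon> a) P) Sa" "p \<le> measure_pmf.prob (run b (T \<epsilon> b) P) Sb"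
    using correct[OF in_inputs(1)] correct[OF in_inputs(2)]
    by (simp_all add: P_def Sa_def Sb_def a_def b_def)
  moreover have "measure_pmf.prob (run a (T \<epsilon> a) P) Sa \<le> measure_pmf.prob (run a t P) Sa"
    "measure_pmf.prob (run b (T \<epsilon> b) P) Sb \<le> measure_pmf.prob (run b t P) Sb"
    by (auto intro!: prob_run_mono simp: Sa_def Sb_def t_def)
  ultimately have pa: "p \<le> measure_pmf.prob (run a t P) Sa"
    and pb: "p \<le> measure_pmf.prob (run b t P) Sb"
    by auto
  have "{i. i < length a \<and> a ! i \<noteq> b ! i} = {0}"
    by (auto simp: a_def b_def nth_Cons' split: if_splits)
  then have "measure_pmf.prob (run a t P) Sa \<le> measure_pmf.prob (run b t P) Sa + real t / Suc n"
    using prob_run_diff[of a b t P Sa] by (simp add: a_def b_def)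
  moreover have "real t / Suc n \<le> c"
  proof -
    \<comment> \<open>The bound for \<open>b\<close> is smaller by its sum 4; weakening it makes
      both time bounds at most \<open>c * Suc n\<close>.\<close>
    have "c * (Suc n / 4) \<le> c * Suc n"
      using c by (intro mult_left_mono) auto
    then have "real t \<le> c * Suc n"
      using Ta Tb by (auto simp: t_def a_def b_def max_def)
    then show ?thesis
      by (simp add: pos_divide_le_eq)
  qed
  moreover have "measure_pmf.prob (run b t P) Sa + measure_pmf.prob (run b t P) Sb \<le> 1"
  proof -
    \<comment> \<open>Approximations for \<open>a\<close> are at most 3/2, those for
      \<open>b\<close> at least 4 / (3/2) = 8/3.\<close>
    have "Sa \<inter> Sb = {}"
      by (auto simp: Sa_def Sb_def is_approximation_def a_def b_def \<epsilon>_def sum_list_replicate)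
    then have "measure_pmf.prob (run b t P) Sa + measure_pmf.prob (run b t P) Sb
        = measure_pmf.prob (run b t P) (Sa \<union> Sb)"
      by (simp add: measure_pmf.finite_measure_Union)
    then show ?thesis
      by simp
  qed
  ultimately show False
    using pa pb assms by (simp add: c_def)
qed

end
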